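(* Let $\mathbb{K}$ be an algebraically closed field of characteristic zero. For every series root $\phi$ of a non-zero square-free polynomial $p\in\mathbb{K}[\mathbf{x},y]$, there is a surjection from the set of (admissible) edges of the Newton polytope of $p$ which give rise to $\phi$ to the set of vertices of the convex hull of $\mathrm{supp}(\phi)$.
   Context: $\mathbf{x}=(x_1,\dots,x_n)$. A series over $\mathbb{K}$ is a formal sum $\phi=\sum_{I\in\mathbb{Q}^n}a_I\mathbf{x}^I$ whose support $\mathrm{supp}(\phi)=\{I:a_I\neq0\}$ is contained in $(v+C)\cap\frac1k\mathbb{Z}^n$ for some $v\in\mathbb{R}^n$, some strictly convex (convex, containing no line) rational (generated by finitely many integer vectors) cone $C\subseteq\mathbb{R}^n$ and some non-zero integer $k$; it is a series root of $p$ if $p(\mathbf{x},\phi)=0$. A vector $w\in\mathbb{R}^n$ with components linearly independent over $\mathbb{Q}$ induces the total order $\alpha\preceq\beta\Leftrightarrow\alpha\cdot w\le\beta\cdot w$ on $\mathbb{Q}^n$; a cone $C$ is compatible with $w$ if $C\cap\mathbb{Q}^n$ has a maximal element with respect to $\preceq$. $\mathbb{K}_{\preceq}((\mathbf{x}))$ is the field of series whose support is contained in $u+C$ for some $u\in\mathbb{Q}^n$ and some compatible strictly convex rational cone $C$. The leading exponent of a non-zero element of it is the maximal element of its support. $\mathrm{Newt}(p)\subseteq\mathbb{R}^{n+1}$ is the convex hull of $\mathrm{supp}(p)$. An edge $e=\{v_1,v_2\}$ of it is admissible if $v_{1,n+1}\ne v_{2,n+1}$; its slope is $\mathrm{S}(e)=\frac{1}{v_{2,n+1}-v_{1,n+1}}(v_{2,1}-v_{1,1},\dots,v_{2,n}-v_{1,n})$.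 Let $P_e$ be the projection of $\mathbb{R}^{n+1}$ onto $\mathbb{R}^n\times\{0\}\cong\mathbb{R}^n$ along lines parallel to $e$. The barrier cone $C(e)\subseteq\mathbb{R}^n$ is the smallest (convex) cone containing $P_e(\mathrm{Newt}(p))-P_e(e)$, and $C^*(e)=\{w\in\mathbb{R}^n: v\cdot w\le0\text{ for all }v\in C(e)\}$. For square-free $p$, an admissible edge $e$, and $w\in C^*(e)$ inducing a total order $\preceq$, the series roots constructed from $e$ and $w$ (by the Newton-Puiseux algorithm) are the roots of $p$ in $\mathbb{K}_{\preceq}((\mathbf{x}))$ whose leading exponent is $-\mathrm{S}(e)$. An edge $e$ gives rise to $\phi$ if there is a $w\in C^*(e)$ inducing a total order on $\mathbb{Q}^n$ such that $\phi$ is among the series roots constructed from $e$ and $w$. *)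

theory Defs
  imports
    "HOL-Analysis.Analysis"
    "HOL-Library.Poly_Mapping"
    "HOL-Computational_Algebra.Polynomial"
    "HOL-Computational_Algebra.Squarefree"
begin

text \<open>
  The number of variables \<open>x\<^sub>1, \<dots>, x\<^sub>n\<close> is the cardinality of the index type \<open>'n\<close>.
  The ring \<open>\<bbbK>[x][y]\<close> is \<open>(('n \<Rightarrow>\<^sub>0 nat) \<Rightarrow>\<^sub>0 'k) poly\<close>, and \<open>\<real>\<close> to the power \<open>n + 1\<close> is
  \<open>(real^'n) \<times> real\<close>, the last component belonging to \<open>y\<close>.
\<close>

definition real_vec :: "rat^'n \<Rightarrow> real^'n" where
  "real_vec I = (\<chi> i. of_rat (I $ i))"

definition rat_exponent :: "('n::finite \<Rightarrow>\<^sub>0 nat) \<Rightarrow> rat^'n" where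
  "rat_exponent m = (\<chi> i. of_nat (Poly_Mapping.lookup m i))"

definition strictly_convex_rational_cone :: "(real^'n) set \<Rightarrow> bool" where
  "strictly_convex_rational_cone C \<longleftrightarrow>
     (\<exists>S. finite S \<and> (\<forall>s\<in>S. \<forall>i. s $ i \<in> \<int>) \<and> C = convex_cone hull S) \<and>
     \<not> (\<exists>a d. d \<noteq> 0 \<and> (\<forall>t. a + t *\<^sub>R d \<in> C))"


subsection \<open>Series\<close>

type_synonym ('n, 'k) formal_sum = "rat^'n \<Rightarrow> 'k"

definition series_support :: "('n::finite, 'k::zero) formal_sum \<Rightarrow> (rat^'n) set" where
  "series_support \<phi> = {I. \<phi> I \<noteq> 0}"

definition is_series :: "('n::finite, 'k::zero) formal_sum \<Rightarrow> bool" where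
  "is_series \<phi> \<longleftrightarrow>
     (\<exists>v C. \<exists>k::int. strictly_convex_rational_cone C \<and> k \<noteq> 0 \<and>
        (\<forall>I\<in>series_support \<phi>. real_vec I \<in> (+) v ` C \<and> (\<forall>i. of_int k * I $ i \<in> \<int>)))"

text \<open>
  The index set of the sum below is finite if one factor has finite support, or if the supports of
  both factors lie in translates of the same strictly convex cone and in the same lattice. This
  covers all the products needed to substitute a single series into a polynomial, although
  the product of two arbitrary series may be undefined.
\<close>
definition series_mult ::
  "('n::finite, 'k::comm_ring_1) formal_sum \<Rightarrow> ('n, 'k) formal_sum \<Rightarrow> ('n, 'k) formal_sum" where
  "series_mult \<phi> \<psi> = (\<lambda>I. \<Sum>J | \<phi> J \<noteq> 0 \<and> \<psi> (I - J) \<noteq> 0. \<phi> J * \<psi> (I - J))"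

primrec series_power :: "('n::finite, 'k::comm_ring_1) formal_sum \<Rightarrow> nat \<Rightarrow> ('n, 'k) formal_sum" where
  "series_power \<phi> 0 = (\<lambda>I. if I = 0 then 1 else 0)"
| "series_power \<phi> (Suc j) = series_mult \<phi> (series_power \<phi> j)"

definition series_of_coeff ::
  "(('n::finite \<Rightarrow>\<^sub>0 nat) \<Rightarrow>\<^sub>0 'k::comm_ring_1) \<Rightarrow> ('n, 'k) formal_sum" where
  "series_of_coeff q = (\<lambda>I. \<Sum>m | m \<in> Poly_Mapping.keys q \<and> rat_exponent m = I. Poly_Mapping.lookup q m)"

definition series_eval ::
  "(('n::finite \<Rightarrow>\<^sub>0 nat) \<Rightarrow>\<^sub>0 'k::comm_ring_1) poly \<Rightarrow> ('n, 'k) formal_sum \<Rightarrow> ('n, 'k) formal_sum" where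
  "series_eval p \<phi> =
     (\<lambda>I. \<Sum>j\<le>degree p. series_mult (series_of_coeff (coeff p j)) (series_power \<phi> j) I)"

definition is_series_root ::
  "(('n::finite \<Rightarrow>\<^sub>0 nat) \<Rightarrow>\<^sub>0 'k::comm_ring_1) poly \<Rightarrow> ('n, 'k) formal_sum \<Rightarrow> bool" where
  "is_series_root p \<phi> \<longleftrightarrow> is_series \<phi> \<and> series_eval p \<phi> = (\<lambda>I. 0)"


subsection \<open>Orders on exponents\<close>

definition induces_total_order :: "real^'n \<Rightarrow> bool" where
  "induces_total_order w \<longleftrightarrow>
     (\<forall>c::'n \<Rightarrow> rat. (\<Sum>i\<in>UNIV. of_rat (c i) * w $ i) = 0 \<longrightarrow> (\<forall>i. c i = 0))"

definition exp_le :: "real^'n \<Rightarrow> rat^'n \<Rightarrow> rat^'n \<Rightarrow> bool" where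
  "exp_le w I J \<longleftrightarrow> real_vec I \<bullet> w \<le> real_vec J \<bullet> w"

definition exp_maximal :: "real^'n \<Rightarrow> (rat^'n) set \<Rightarrow> rat^'n \<Rightarrow> bool" where
  "exp_maximal w A I \<longleftrightarrow> I \<in> A \<and> (\<forall>J\<in>A. exp_le w J I)"

definition compatible_cone :: "real^'n \<Rightarrow> (real^'n) set \<Rightarrow> bool" where
  "compatible_cone w C \<longleftrightarrow> (\<exists>I. exp_maximal w {J. real_vec J \<in> C} I)"

definition series_field :: "real^'n \<Rightarrow> ('n::finite, 'k::zero) formal_sum set" where
  "series_field w =
     {\<phi>. is_series \<phi> \<and>
         (\<exists>u C. strictly_convex_rational_cone C \<and> compatible_cone w C \<and>
            real_vec ` series_support \<phi> \<subseteq> (+) (real_vec u) ` C)}"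

text \<open>A relation and not a function: the zero series has no leading exponent.\<close>
definition leading_exponent :: "real^'n \<Rightarrow> ('n::finite, 'k::zero) formal_sum \<Rightarrow> rat^'n \<Rightarrow> bool" where
  "leading_exponent w \<phi> I \<longleftrightarrow> exp_maximal w (series_support \<phi>) I"


subsection \<open>The Newton polytope and its edges\<close>

definition poly_support ::
  "(('n::finite \<Rightarrow>\<^sub>0 nat) \<Rightarrow>\<^sub>0 'k::comm_ring_1) poly \<Rightarrow> ((real^'n) \<times> real) set" where
  "poly_support p = {(real_vec (rat_exponent m), of_nat j) | m j. Poly_Mapping.lookup (coeff p j) m \<noteq> 0}"

definition Newt ::
  "(('n::finite \<Rightarrow>\<^sub>0 nat) \<Rightarrow>\<^sub>0 'k::comm_ring_1) poly \<Rightarrow> ((real^'n) \<times> real) set" where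
  "Newt p = convex hull (poly_support p)"

definition admissible_edge ::
  "(('n::finite \<Rightarrow>\<^sub>0 nat) \<Rightarrow>\<^sub>0 'k::comm_ring_1) poly \<Rightarrow> ((real^'n) \<times> real) set \<Rightarrow> bool" where
  "admissible_edge p e \<longleftrightarrow>
     e edge_of Newt p \<and> (\<exists>v1 v2. e = closed_segment v1 v2 \<and> snd v1 \<noteq> snd v2)"

definition slope :: "((real^'n) \<times> real) set \<Rightarrow> real^'n" where
  "slope e = (THE s. \<exists>v1 v2. e = closed_segment v1 v2 \<and> snd v1 \<noteq> snd v2 \<and>
                       s = (1 / (snd v2 - snd v1)) *\<^sub>R (fst v2 - fst v1))"

lemma slope_closed_segment:
  fixes v1 v2 :: "(real^'n) \<times> real"
  assumes "snd v1 \<noteq> snd v2"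
  shows "slope (closed_segment v1 v2) = (1 / (snd v2 - snd v1)) *\<^sub>R (fst v2 - fst v1)"
  unfolding slope_def
proof (rule the_equality)
  fix s :: "real^'n"
  assume "\<exists>u1 u2. closed_segment v1 v2 = closed_segment u1 u2 \<and> snd u1 \<noteq> snd u2 \<and>
            s = (1 / (snd u2 - snd u1)) *\<^sub>R (fst u2 - fst u1)"
  then obtain u1 u2 where u: "closed_segment v1 v2 = closed_segment u1 u2"
    and s: "s = (1 / (snd u2 - snd u1)) *\<^sub>R (fst u2 - fst u1)" by blast
  from u have "{v1, v2} = {u1, u2}"
    by (simp add: closed_segment_eq)
  then consider "u1 = v1" "u2 = v2" | "u1 = v2" "u2 = v1"
    by (auto simp: doubleton_eq_iff)
  then show "s = (1 / (snd v2 - snd v1)) *\<^sub>R (fst v2 - fst v1)"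
  proof cases
    case 2
    have "1 / (snd v1 - snd v2) = - (1 / (snd v2 - snd v1))"
      by (metis minus_diff_eq minus_divide_right)
    then show ?thesis using s 2 by (simp add: scaleR_diff_right)
  qed (use s in simp)
qed (use assms in blast)

text \<open>
  The projection along \<open>e\<close> onto the hyperplane on which the last component vanishes. The vector
  \<open>(slope e, 1)\<close> spans the direction of \<open>e\<close>.
\<close>
definition edge_proj :: "((real^'n) \<times> real) set \<Rightarrow> (real^'n) \<times> real \<Rightarrow> real^'n" where
  "edge_proj e u = fst u - snd u *\<^sub>R slope e"

lemma edge_proj_iff:
  fixes v1 v2 u :: "(real^'n) \<times> real"
  assumes "snd v1 \<noteq> snd v2"
  shows "q = edge_proj (closed_segment v1 v2) u \<longleftrightarrow> (\<exists>t. (q, 0) = u + t *\<^sub>R (v2 - v1))"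
proof
  assume q: "q = edge_proj (closed_segment v1 v2) u"
  have "(q, 0) = u + (- snd u / (snd v2 - snd v1)) *\<^sub>R (v2 - v1)"
    using assms by (simp add: q edge_proj_def slope_closed_segment prod_eq_iff)
  then show "\<exists>t. (q, 0) = u + t *\<^sub>R (v2 - v1)" ..
next
  assume "\<exists>t. (q, 0) = u + t *\<^sub>R (v2 - v1)"
  then obtain t where t: "q = fst u + t *\<^sub>R (fst v2 - fst v1)" "0 = snd u + t * (snd v2 - snd v1)"
    by (auto simp: prod_eq_iff)
  from t(2) assms have "t = - snd u / (snd v2 - snd v1)"
    by (simp add: field_simps)
  with t(1) assms show "q = edge_proj (closed_segment v1 v2) u"
    by (simp add: edge_proj_def slope_closed_segment)
qed

definition barrier_cone ::
  "(('n::finite \<Rightarrow>\<^sub>0 nat) \<Rightarrow>\<^sub>0 'k::comm_ring_1) poly \<Rightarrow> ((real^'n) \<times> real) set \<Rightarrow> (real^'n) set" where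
  "barrier_cone p e = convex_cone hull {edge_proj e u - edge_proj e v | u v. u \<in> Newt p \<and> v \<in> e}"

definition dual_barrier_cone ::
  "(('n::finite \<Rightarrow>\<^sub>0 nat) \<Rightarrow>\<^sub>0 'k::comm_ring_1) poly \<Rightarrow> ((real^'n) \<times> real) set \<Rightarrow> (real^'n) set" where
  "dual_barrier_cone p e = {w. \<forall>v\<in>barrier_cone p e. v \<bullet> w \<le> 0}"

definition constructed_series_roots ::
  "(('n::finite \<Rightarrow>\<^sub>0 nat) \<Rightarrow>\<^sub>0 'k::comm_ring_1) poly \<Rightarrow> ((real^'n) \<times> real) set \<Rightarrow> real^'n \<Rightarrow>
    ('n, 'k) formal_sum set" where
  "constructed_series_roots p e w =
     {\<phi> \<in> series_field w. is_series_root p \<phi> \<and>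
        (\<exists>I. leading_exponent w \<phi> I \<and> real_vec I = - slope e)}"

definition gives_rise_to ::
  "(('n::finite \<Rightarrow>\<^sub>0 nat) \<Rightarrow>\<^sub>0 'k::comm_ring_1) poly \<Rightarrow> ((real^'n) \<times> real) set \<Rightarrow>
    ('n, 'k) formal_sum \<Rightarrow> bool" where
  "gives_rise_to p e \<phi> \<longleftrightarrow>
     (\<exists>w \<in> dual_barrier_cone p e. induces_total_order w \<and> \<phi> \<in> constructed_series_roots p e w)"


subsection \<open>Vertices\<close>

text \<open>
  A vertex is a point cut out by a supporting hyperplane. As the convex hull of the support of a
  series need not be closed, this is in general stronger than being an extreme point: for the
  series \<open>1 + x + y \<Sum>\<^sub>m\<^sub>\<ge>\<^sub>0 x\<^sup>-\<^sup>m\<close>, the origin is an extreme point of that hull, but it is not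
  an exposed one (and not a face of the closure of the hull).
\<close>
definition vertices :: "'a::euclidean_space set \<Rightarrow> 'a set" where
  "vertices S = {v. {v} exposed_face_of S}"

end

theory Submission
  imports Defs
begin

text \<open>
  The surjection is \<open>e \<mapsto> - slope e\<close>. If \<open>e\<close> gives rise to \<open>\<phi>\<close> by means of \<open>w\<close>, then \<open>- slope e\<close> is the
  leading exponent of \<open>\<phi>\<close>, hence a vertex, as \<open>w\<close> attains its maximum over the support only there.

  Conversely, let the functional \<open>a\<close> expose the vertex \<open>v\<close>. Take \<open>c\<close> in the interior of the dual of
  the cone that contains the support up to translation. Far away from \<open>v\<close>, \<open>c\<close> decreases linearly
  along the support, and near \<open>v\<close> there are only finitely many exponents, as they lie in a lattice.
  So for small \<open>\<epsilon> > 0\<close> the functional \<open>a + \<epsilon> c\<close> decreases linearly from \<open>v\<close>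
  on the whole support. This persists under small perturbations, one of which is a \<open>w\<close> inducing
  a total order, for which \<open>\<phi>\<close> lies in the field of \<open>w\<close> and has the leading exponent \<open>v\<close>. In
  \<open>p(x, \<phi>) = 0\<close> the terms of highest order must cancel, so that the functional \<open>(w, v \<bullet> w)\<close> attains
  its maximum over the support of \<open>p\<close> at two points at least. The points where it is attained lie on a
  line with direction \<open>(-v, 1)\<close>, as \<open>w\<close> induces a total order. They span the edge.
\<close>

section \<open>Rational exponents as real vectors\<close>

lemma real_vec_0 [simp]: "real_vec 0 = 0"
  by (simp add: real_vec_def vec_eq_iff)

lemma real_vec_add: "real_vec (I + J) = real_vec I + real_vec J"
  by (simp add: real_vec_def vec_eq_iff of_rat_add)

lemma real_vec_diff: "real_vec (I - J) = real_vec I - real_vec J"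
  by (simp add: real_vec_def vec_eq_iff of_rat_diff)

lemma real_vec_eq_iff [simp]: "real_vec I = real_vec J \<longleftrightarrow> I = J"
  by (simp add: real_vec_def vec_eq_iff)

lemma real_vec_of_nat_mult: "real_vec (of_nat j *s I) = real j *\<^sub>R real_vec I"
  by (simp add: real_vec_def vec_eq_iff of_rat_mult)

section \<open>Linear decrease on convex cones\<close>

text \<open>Since the norm is subadditive and \<open>\<delta>\<close> is non-negative, the vectors
  that satisfy the bound form a convex cone. It is therefore enough to check generators.\<close>

lemma norm_bound_convex_cone_hull:
  fixes c :: "'a::euclidean_space"
  assumes "0 \<le> \<delta>" and S: "\<And>s. s \<in> S \<Longrightarrow> c \<bullet> s \<le> - \<delta> * norm s"
    and u: "u \<in> convex_cone hull S"
  shows "c \<bullet> u \<le> - \<delta> * norm u"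
proof -
  have "convex_cone {u. c \<bullet> u \<le> - \<delta> * norm u}"
    unfolding convex_cone_iff
  proof (intro conjI ballI allI impI)
    fix x y assume "x \<in> {u. c \<bullet> u \<le> - \<delta> * norm u}" "y \<in> {u. c \<bullet> u \<le> - \<delta> * norm u}"
    moreover have "\<delta> * norm (x + y) \<le> \<delta> * (norm x + norm y)"
      using assms(1) norm_triangle_ineq by (rule mult_left_mono[rotated])
    ultimately show "x + y \<in> {u. c \<bullet> u \<le> - \<delta> * norm u}"
      by (simp add: inner_add_right algebra_simps)
  next
    fix x :: 'a and t :: real assume x: "x \<in> {u. c \<bullet> u \<le> - \<delta> * norm u}" and t: "0 \<le> t"
    have "t * (c \<bullet> x) \<le> t * (- \<delta> * norm x)"
      using x t by (intro mult_left_mono) auto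
    then show "t *\<^sub>R x \<in> {u. c \<bullet> u \<le> - \<delta> * norm u}"
      using t by (simp add: algebra_simps)
  qed simp
  then have "convex_cone hull S \<subseteq> {u. c \<bullet> u \<le> - \<delta> * norm u}"
    using S by (intro hull_minimal) auto
  with u show ?thesis by blast
qed

text \<open>Any \<open>\<delta>\<close> below the finitely many positive ratios
  \<open>- (c \<bullet> s) / norm s\<close> with \<open>s \<noteq> 0\<close> works.\<close>

lemma finite_set_norm_bound:
  fixes c :: "'a::euclidean_space"
  assumes "finite S" and neg: "\<And>s. s \<in> S \<Longrightarrow> s \<noteq> 0 \<Longrightarrow> c \<bullet> s < 0"
  obtains \<delta> where "0 < \<delta>" "\<And>s. s \<in> S \<Longrightarrow> c \<bullet> s \<le> - \<delta> * norm s"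
proof -
  have "\<exists>\<delta>>0. \<forall>s\<in>S. c \<bullet> s \<le> - \<delta> * norm s"
    using assms
  proof (induction S rule: finite_induct)
    case empty
    show ?case by (rule exI[of _ 1]) simp
  next
    case (insert x S)
    then obtain \<delta> where \<delta>: "0 < \<delta>" "\<forall>s\<in>S. c \<bullet> s \<le> - \<delta> * norm s" by auto
    \<comment> \<open>For \<open>x = 0\<close> the quotient would be 0 / 0 = 0, and the minimum
      would no longer be positive.\<close>
    define \<epsilon> where "\<epsilon> = (if x = 0 then \<delta> else min \<delta> (- (c \<bullet> x) / norm x))"
    have pos: "0 < \<epsilon>" and le: "\<epsilon> \<le> \<delta>"
      using \<delta>(1) insert.prems by (auto simp: \<epsilon>_def divide_neg_pos)
    have "c \<bullet> x \<le> - \<epsilon> * norm x"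
    proof (cases "x = 0")
      case False
      then have "\<epsilon> \<le> - (c \<bullet> x) / norm x" by (simp add: \<epsilon>_def)
      with False show ?thesis by (simp add: field_simps)
    qed simp
    moreover have "c \<bullet> s \<le> - \<epsilon> * norm s" if "s \<in> S" for s
      using \<delta>(2) that mult_right_mono[OF le norm_ge_zero, of s] by fastforce
    ultimately show ?case using pos by blast
  qed
  then show thesis using that by blast
qed

text \<open>A vanishing convex combination of non-zero generators would put a line into
  \<open>C\<close>. Hence 0 lies outside their compact convex hull, and the negative of a separating
  functional is strictly negative on each of them.\<close>

lemma strictly_convex_rational_cone_dual_interior:
  assumes "strictly_convex_rational_cone C"
  obtains c \<delta> where "0 < \<delta>" "\<And>u. u \<in> C \<Longrightarrow> c \<bullet> u \<le> - \<delta> * norm u"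
proof -
  obtain S where S: "finite S" and C: "C = convex_cone hull S"
    using assms unfolding strictly_convex_rational_cone_def by (elim conjE exE) (rule that)
  have noline: "d = 0" if "\<And>t. a + t *\<^sub>R d \<in> C" for a d
    using assms that unfolding strictly_convex_rational_cone_def by (elim conjE) metis
  have "0 \<notin> convex hull (S - {0})"
  proof
    assume "0 \<in> convex hull (S - {0})"
    then obtain l where l: "\<forall>s\<in>S - {0}. 0 \<le> l s" "sum l (S - {0}) = 1"
      "(\<Sum>s\<in>S - {0}. l s *\<^sub>R s) = 0"
      unfolding convex_hull_finite[OF finite_Diff[OF S]] by blast
    have "sum l (S - {0}) \<noteq> 0" using l(2) by simp
    then obtain s where s: "s \<in> S - {0}" "l s \<noteq> 0"
      by (rule sum.not_neutral_contains_not_neutral)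
    have ls: "0 < l s" using l(1) s by (simp add: order_less_le)
    have mem: "convex_cone C" "S \<subseteq> C"
      by (simp_all add: C convex_cone_convex_cone_hull hull_subset)
    have part: "(\<Sum>s\<in>T. l s *\<^sub>R s) \<in> C" if "T \<subseteq> S - {0}" for T
    proof -
      have "finite T" using that S by (meson finite_Diff finite_subset)
      then show ?thesis using that
      proof (induction T rule: finite_induct)
        case empty
        then show ?case using mem(1) by (simp add: convex_cone_contains_0)
      next
        case (insert x T)
        have "l x *\<^sub>R x \<in> C"
          using l(1) mem insert.prems by (intro convex_cone_scaleR[OF mem(1)]) auto
        with insert show ?case by (simp add: convex_cone_add[OF mem(1)])
      qed
    qed
    \<comment> \<open>The rest of the vanishing combination equals
      \<open>- (l s *\<^sub>R s)\<close>. So \<open>C\<close> contains \<open>- s\<close> as well as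
      \<open>s\<close>, and with them the line through both.\<close>
    have "(\<Sum>r\<in>S - {0} - {s}. l r *\<^sub>R r) \<in> C" by (rule part) auto
    moreover have "(\<Sum>r\<in>S - {0} - {s}. l r *\<^sub>R r) = - (l s *\<^sub>R s)"
    proof -
      have "(\<Sum>r\<in>S - {0}. l r *\<^sub>R r) = l s *\<^sub>R s + (\<Sum>r\<in>S - {0} - {s}. l r *\<^sub>R r)"
        using S s by (intro sum.remove) auto
      then have "l s *\<^sub>R s + (\<Sum>r\<in>S - {0} - {s}. l r *\<^sub>R r) = 0"
        unfolding l(3) by (rule sym)
      then show ?thesis by (rule minus_unique[symmetric])
    qed
    ultimately have "- (l s *\<^sub>R s) \<in> C" by simp
    then have "(1 / l s) *\<^sub>R (- (l s *\<^sub>R s)) \<in> C"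
      using mem(1) ls by (intro convex_cone_scaleR) auto
    then have ms: "- s \<in> C" using ls by simp
    have "0 + t *\<^sub>R s \<in> C" for t
    proof (cases "0 \<le> t")
      case True
      then show ?thesis using mem s by (simp add: convex_cone_scaleR subset_iff)
    next
      case False
      then have "(- t) *\<^sub>R (- s) \<in> C" using mem ms by (intro convex_cone_scaleR) auto
      then show ?thesis by simp
    qed
    then have "s = 0" by (rule noline)
    with s show False by simp
  qed
  moreover have "closed (convex hull (S - {0}))"
    using S by (simp add: compact_convex_hull compact_imp_closed finite_imp_compact)
  ultimately obtain a b where ab: "0 < b" "\<And>x. x \<in> convex hull (S - {0}) \<Longrightarrow> b < a \<bullet> x"
    using separating_hyperplane_closed_0[OF convex_convex_hull] by metis
  have "(- a) \<bullet> s < 0" if "s \<in> S" "s \<noteq> 0" for s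
    using ab(1) ab(2)[of s] that by (simp add: hull_inc)
  then obtain \<delta> where \<delta>: "0 < \<delta>" "\<And>s. s \<in> S \<Longrightarrow> (- a) \<bullet> s \<le> - \<delta> * norm s"
    using finite_set_norm_bound[OF S, of "- a"] by blast
  have "(- a) \<bullet> u \<le> - \<delta> * norm u" if "u \<in> C" for u
    by (rule norm_bound_convex_cone_hull[OF less_imp_le[OF \<delta>(1)] \<delta>(2) that[unfolded C]])
  with \<delta>(1) show thesis by (rule that)
qed

lemma finite_vec_entries:
  assumes "finite T"
  shows "finite {x::'a^'n. \<forall>i. x $ i \<in> T}"
proof -
  have "{x::'a^'n. \<forall>i. x $ i \<in> T} \<subseteq> vec_lambda ` (UNIV \<rightarrow>\<^sub>E T)"
  proof
    fix x :: "'a^'n" assume "x \<in> {x. \<forall>i. x $ i \<in> T}"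
    then have "vec_nth x \<in> UNIV \<rightarrow>\<^sub>E T" by auto
    then show "x \<in> vec_lambda ` (UNIV \<rightarrow>\<^sub>E T)"
      by (metis image_eqI vec_nth_inverse)
  qed
  then show ?thesis
    using assms by (meson finite finite_PiE finite_imageI finite_subset)
qed

text \<open>The vectors with \<open>w \<bullet> u \<le> - \<delta> * norm u\<close> form a round
  cone, which is in general not finitely generated. Membership in \<open>series_field w\<close>
  requires a rational cone around it on which \<open>w\<close> is still bounded above.\<close>

lemma negative_cone_in_strictly_convex_rational_cone:
  fixes w :: "real^'n"
  assumes \<delta>: "0 < \<delta>"
  obtains C where "strictly_convex_rational_cone C" "compatible_cone w C"
    "\<And>u. w \<bullet> u \<le> - \<delta> * norm u \<Longrightarrow> u \<in> C"
proof -
  define n where "n = real CARD('n)"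
  have n1: "1 \<le> n" by (simp add: n_def)
  \<comment> \<open>The cone is generated by the integer vectors of bounded size on which \<open>w\<close> is negative: for a
    given \<open>u\<close>, scaled to length \<open>N\<close>, \<open>w\<close> is negative on all lattice points close to \<open>u\<close>.\<close>
  define N where "N = (norm w + 1) * (2 * n) / \<delta>"
  \<comment> \<open>This bounds the coordinates of every lattice point that differs by at most
    \<open>n\<close> in each coordinate from a vector of length \<open>N\<close>.\<close>
  define R where "R = N + n + 1"
  have N: "0 < N" using \<delta> n1 by (simp add: N_def add_nonneg_pos)
  define S where "S = {z::real^'n. (\<forall>i. z $ i \<in> real_of_int ` {- \<lceil>R\<rceil>..\<lceil>R\<rceil>}) \<and> w \<bullet> z < 0}"
  have fin: "finite S"
    unfolding S_def
    by (rule finite_subset[OF _ finite_vec_entries[of "real_of_int ` {- \<lceil>R\<rceil>..\<lceil>R\<rceil>}"]]) auto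
  obtain \<epsilon> where \<epsilon>: "0 < \<epsilon>" "\<And>u. u \<in> convex_cone hull S \<Longrightarrow> w \<bullet> u \<le> - \<epsilon> * norm u"
  proof -
    have "w \<bullet> s < 0" if "s \<in> S" for s using that by (simp add: S_def)
    then obtain \<epsilon> where "0 < \<epsilon>" "\<And>s. s \<in> S \<Longrightarrow> w \<bullet> s \<le> - \<epsilon> * norm s"
      using finite_set_norm_bound[OF fin] by blast
    then show thesis using that norm_bound_convex_cone_hull[of \<epsilon> S w] by simp
  qed
  show thesis
  proof
    have "d = 0" if line: "\<And>t. a + t *\<^sub>R d \<in> convex_cone hull S" for a d
    proof (rule ccontr)
      assume "d \<noteq> 0"
      have bound: "w \<bullet> a + t * (w \<bullet> d) + \<epsilon> * norm (a + t *\<^sub>R d) \<le> 0" for t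
        using \<epsilon>(2)[OF line[of t]] by (simp add: inner_add_right)
      \<comment> \<open>With this \<open>t\<close>, both \<open>a + t *\<^sub>R d\<close> and
        \<open>a - t *\<^sub>R d\<close> have norm at least
        \<open>(\<bar>w \<bullet> a\<bar> + 1) / \<epsilon>\<close>. Adding the bounds at these two
        points cancels \<open>w \<bullet> d\<close> and contradicts the size of
        \<open>w \<bullet> a\<close>.\<close>
      define t where "t = (norm a + (\<bar>w \<bullet> a\<bar> + 1) / \<epsilon>) / norm d"
      have td: "\<bar>t\<bar> * norm d = norm a + (\<bar>w \<bullet> a\<bar> + 1) / \<epsilon>"
        using \<open>d \<noteq> 0\<close> \<epsilon>(1) by (simp add: t_def)
      have big: "\<epsilon> * norm (a + s *\<^sub>R d) \<ge> \<bar>w \<bullet> a\<bar> + 1" if "\<bar>s\<bar> = \<bar>t\<bar>" for s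
      proof -
        have "norm (s *\<^sub>R d) \<le> norm (a + s *\<^sub>R d) + norm a"
          by (metis add_diff_cancel_left' norm_triangle_ineq4)
        then have "norm (a + s *\<^sub>R d) \<ge> (\<bar>w \<bullet> a\<bar> + 1) / \<epsilon>"
          using td that by simp
        then show ?thesis using \<epsilon>(1) by (simp add: field_simps)
      qed
      have "w \<bullet> a + t * (w \<bullet> d) \<le> - \<bar>w \<bullet> a\<bar> - 1"
        using bound[of t] big[of t] by simp
      moreover have "w \<bullet> a - t * (w \<bullet> d) \<le> - \<bar>w \<bullet> a\<bar> - 1"
        using bound[of "- t"] big[of "- t"] by simp
      ultimately show False by linarith
    qed
    then show "strictly_convex_rational_cone (convex_cone hull S)"
      unfolding strictly_convex_rational_cone_def
      using fin by (auto simp: S_def intro!: exI[of _ S]) (metis Ints_of_int imageE)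
    have "w \<bullet> u \<le> 0" if "u \<in> convex_cone hull S" for u
      using \<epsilon>(2)[OF that] \<epsilon>(1) by (smt (verit) mult_nonneg_nonneg norm_ge_zero mult_minus_left)
    then show "compatible_cone w (convex_cone hull S)"
      unfolding compatible_cone_def exp_maximal_def exp_le_def
      by (auto intro!: exI[of _ 0] simp: convex_cone_hull_contains_0 inner_commute[of _ w])
    fix u :: "real^'n" assume u: "w \<bullet> u \<le> - \<delta> * norm u"
    show "u \<in> convex_cone hull S"
    proof (cases "u = 0")
      case True
      then show ?thesis by (simp add: convex_cone_hull_contains_0)
    next
      case False
      define x where "x = (N / norm u) *\<^sub>R u"
      have nx: "norm x = N" using False N by (simp add: x_def)
      have "w \<bullet> x = (N / norm u) * (w \<bullet> u)" by (simp add: x_def)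
      also have "\<dots> \<le> (N / norm u) * (- \<delta> * norm u)"
        using u N by (intro mult_left_mono) auto
      also have "\<dots> = - \<delta> * N" using False by simp
      finally have wx: "w \<bullet> x \<le> - ((norm w + 1) * (2 * n))"
        using \<delta> by (simp add: N_def)
      \<comment> \<open>A move of length at most \<open>2 * n\<close> raises \<open>w\<close> by at
        most \<open>norm w * (2 * n)\<close>. The choice of \<open>N\<close> leaves a margin of
        \<open>2 * n\<close> beyond that.\<close>
      have near: "z \<in> S" if z: "\<And>i. z $ i \<in> \<int>" "norm (z - x) \<le> 2 * n" "\<And>i. \<bar>z $ i - x $ i\<bar> \<le> n" for z
      proof -
        have "w \<bullet> z = w \<bullet> x + w \<bullet> (z - x)" by (simp add: inner_diff_right)
        also have "\<dots> \<le> w \<bullet> x + norm w * (2 * n)"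
          using Cauchy_Schwarz_ineq2[of w "z - x"] mult_left_mono[OF z(2) norm_ge_zero[of w]]
          by linarith
        also have "\<dots> < 0" using wx n1 by (simp add: algebra_simps)
        finally have "w \<bullet> z < 0" .
        moreover have "z $ i \<in> real_of_int ` {- \<lceil>R\<rceil>..\<lceil>R\<rceil>}" for i
        proof -
          obtain m where m: "z $ i = of_int m" using z(1)[of i] Ints_cases by blast
          have "\<bar>x $ i\<bar> \<le> N" using component_le_norm_cart[of x i] nx by simp
          then have "\<bar>of_int m\<bar> \<le> R" using z(3)[of i] m by (simp add: R_def)
          then have "m \<in> {- \<lceil>R\<rceil>..\<lceil>R\<rceil>}" by (auto simp: le_ceiling_iff abs_le_iff) linarith+
          then show ?thesis using m by blast
        qed
        ultimately show ?thesis by (simp add: S_def)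
      qed
      \<comment> \<open>\<open>x\<close> is the mean of the points \<open>z + n (x\<^sub>i - z\<^sub>i) e\<^sub>i\<close> on the segments from \<open>z\<close> to \<open>z + n e\<^sub>i\<close>.\<close>
      define z where "z = (\<chi> i. real_of_int \<lfloor>x $ i\<rfloor>)"
      have fr: "0 \<le> x $ i - z $ i" "x $ i - z $ i \<le> 1" for i
        by (simp_all add: z_def) linarith+
      then have fr': "\<bar>z $ i - x $ i\<bar> \<le> 1" for i
        by (metis abs_minus_commute abs_of_nonneg)
      have nz: "norm (z - x) \<le> n"
      proof -
        have "norm (z - x) \<le> (\<Sum>i\<in>UNIV. \<bar>(z - x) $ i\<bar>)" by (rule norm_le_l1_cart)
        also have "\<dots> \<le> (\<Sum>i\<in>(UNIV::'n set). 1)"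
          using fr' by (intro sum_mono) simp
        finally show ?thesis by (simp add: n_def)
      qed
      have zS: "z \<in> S"
        using nz n1 fr fr' by (intro near) (auto simp: z_def intro: order_trans)
      have eS: "z + n *\<^sub>R axis i 1 \<in> S" for i
      proof (rule near)
        show "norm (z + n *\<^sub>R axis i 1 - x) \<le> 2 * n"
        proof -
          have "norm ((z - x) + n *\<^sub>R axis i 1) \<le> norm (z - x) + norm (n *\<^sub>R (axis i 1 :: real^'n))"
            by (rule norm_triangle_ineq)
          then show ?thesis using nz n1 by (simp add: norm_axis_1 algebra_simps)
        qed
        show "(z + n *\<^sub>R axis i 1) $ j \<in> \<int>" for j
          by (simp add: z_def n_def axis_def)
        show "\<bar>(z + n *\<^sub>R axis i 1) $ j - x $ j\<bar> \<le> n" for j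
          using fr[of j] n1 by (auto simp: axis_def abs_le_iff)
      qed
      have K: "convex (convex_cone hull S)" "S \<subseteq> convex_cone hull S"
        by (simp_all add: convex_convex_cone_hull hull_subset)
      have "z + (n * f) *\<^sub>R axis i 1 \<in> convex_cone hull S" if "0 \<le> f" "f \<le> 1" for f i
      proof -
        have "(1 - f) *\<^sub>R z + f *\<^sub>R (z + n *\<^sub>R axis i 1) \<in> convex_cone hull S"
          using that zS eS K by (intro convexD_alt) auto
        then show ?thesis by (simp add: algebra_simps)
      qed
      then have "(\<Sum>i\<in>UNIV. (1 / n) *\<^sub>R (z + (n * (x $ i - z $ i)) *\<^sub>R axis i 1)) \<in> convex_cone hull S"
        using fr n1 K(1) by (intro convex_sum) (auto simp: n_def)
      moreover have "(\<Sum>i\<in>UNIV. (1 / n) *\<^sub>R (z + (n * (x $ i - z $ i)) *\<^sub>R axis i 1)) = x"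
      proof -
        have "(\<Sum>i\<in>UNIV. (1 / n) *\<^sub>R (z + (n * (x $ i - z $ i)) *\<^sub>R axis i 1))
            = (\<Sum>i\<in>(UNIV::'n set). (1 / n) *\<^sub>R z) + (\<Sum>i\<in>UNIV. (x - z) $ i *s axis i 1)"
          using n1 unfolding sum.distrib[symmetric]
          by (intro sum.cong) (simp_all add: scaleR_add_right scalar_mult_eq_scaleR)
        also have "\<dots> = z + (x - z)"
          using n1 by (simp only: basis_expansion) (simp add: n_def sum_constant_scaleR del: sum_constant)
        finally show ?thesis by simp
      qed
      ultimately have "(norm u / N) *\<^sub>R x \<in> convex_cone hull S"
        using N by (intro convex_cone_scaleR convex_cone_convex_cone_hull) auto
      then show ?thesis using False N by (simp add: x_def)
    qed
  qed
qed

section \<open>Vectors that induce total orders\<close>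

text \<open>Linear independence over the rationals is applied to \<open>I - J\<close>. This is what
  makes maxima of \<open>w\<close> over sets of exponents unique.\<close>

lemma induces_total_order_inj:
  assumes "induces_total_order w" "real_vec I \<bullet> w = real_vec J \<bullet> w"
  shows "I = J"
proof -
  have "(\<Sum>i\<in>UNIV. of_rat ((I - J) $ i) * w $ i) = 0"
    using assms(2) by (simp add: real_vec_def inner_vec_def of_rat_diff left_diff_distrib sum_subtractf)
  then have "\<forall>i. (I - J) $ i = 0"
    using assms(1) unfolding induces_total_order_def by blast
  then show ?thesis by (simp add: vec_eq_iff)
qed

lemma countable_rat_vec: "countable (UNIV :: (rat^'n) set)"
proof -
  have "countable (UNIV \<rightarrow>\<^sub>E (UNIV :: rat set) :: ('n \<Rightarrow> rat) set)"
    by (intro countable_PiE) auto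
  moreover have "x \<in> vec_lambda ` (UNIV \<rightarrow>\<^sub>E UNIV)" for x :: "rat^'n"
    by (rule image_eqI[of _ _ "vec_nth x"]) auto
  then have "(UNIV :: (rat^'n) set) \<subseteq> vec_lambda ` (UNIV \<rightarrow>\<^sub>E UNIV)" by blast
  ultimately show ?thesis by (meson countable_image countable_subset)
qed

text \<open>The vectors that fail lie on countably many hyperplanes with rational normals. Their
  union is a null set and cannot contain a ball.\<close>

lemma induces_total_order_dense:
  fixes w :: "real^'n"
  assumes "0 < e"
  obtains w' where "induces_total_order w'" "norm (w' - w) < e"
proof -
  define H where "H = (\<lambda>c::rat^'n. {x. real_vec c \<bullet> x = 0})"
  have "(\<Union>c\<in>-{0}. H c) \<in> null_sets lebesgue"
  proof (rule null_sets_UN')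
    show "countable (- {0::rat^'n})" by (rule countable_subset[OF subset_UNIV countable_rat_vec])
    show "H c \<in> null_sets lebesgue" if "c \<in> - {0}" for c
      using that negligible_hyperplane[of "real_vec c" 0] real_vec_eq_iff[of c 0]
      by (simp add: H_def negligible_iff_null_sets del: real_vec_eq_iff)
  qed
  then have neg: "negligible (\<Union>c\<in>-{0}. H c)"
    by (simp add: negligible_iff_null_sets)
  have "\<not> ball w e \<subseteq> (\<Union>c\<in>-{0}. H c)"
  proof
    assume "ball w e \<subseteq> (\<Union>c\<in>-{0}. H c)"
    with neg have "negligible (ball w e)" by (rule negligible_subset)
    moreover have "\<not> negligible (ball w e)"
      using assms by (simp add: open_not_negligible)
    ultimately show False by contradiction
  qed
  then obtain w' where w': "w' \<in> ball w e" "w' \<notin> (\<Union>c\<in>-{0}. H c)"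
    by (meson subsetI)
  have "induces_total_order w'"
    unfolding induces_total_order_def
  proof (intro allI impI)
    fix c :: "'n \<Rightarrow> rat" and i
    assume "(\<Sum>i\<in>UNIV. of_rat (c i) * w' $ i) = 0"
    then have "w' \<in> H (vec_lambda c)" by (simp add: H_def real_vec_def inner_vec_def)
    with w'(2) have "vec_lambda c = 0" by fast
    then show "c i = 0" by (simp add: vec_eq_iff)
  qed
  with w'(1) show thesis by (intro that) (simp_all add: dist_norm norm_minus_commute)
qed

section \<open>Vertices and leading exponents\<close>

text \<open>Each coordinate is a fraction with denominator \<open>k\<close>, whose numerator is
  bounded by \<open>\<bar>k\<bar> * R\<close>.\<close>

lemma finite_lattice_ball:
  assumes "k \<noteq> 0"
  shows "finite {I::rat^'n. (\<forall>i. of_int k * I $ i \<in> \<int>) \<and> norm (real_vec I) \<le> R}"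
proof -
  define N where "N = \<lceil>\<bar>of_int k\<bar> * R\<rceil>"
  have "I $ i \<in> (\<lambda>m. of_int m / of_int k) ` {- N..N}"
    if I: "\<forall>i. of_int k * I $ i \<in> \<int>" "norm (real_vec I) \<le> R" for I :: "rat^'n" and i
  proof -
    obtain m where m: "of_int k * I $ i = of_int m" using I(1) Ints_cases by blast
    have "\<bar>real_of_rat (I $ i)\<bar> \<le> R"
      using component_le_norm_cart[of "real_vec I" i] I(2) by (simp add: real_vec_def)
    then have "\<bar>real_of_int k\<bar> * \<bar>real_of_rat (I $ i)\<bar> \<le> \<bar>of_int k\<bar> * R"
      by (intro mult_left_mono) auto
    moreover have "real_of_int k * real_of_rat (I $ i) = of_int m"
      by (metis m of_rat_mult of_rat_of_int_eq)
    ultimately have "\<bar>real_of_int m\<bar> \<le> \<bar>of_int k\<bar> * R"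
      by (metis abs_mult)
    then have "m \<in> {- N..N}" by (simp add: N_def abs_le_iff) linarith
    moreover have "I $ i = of_int m / of_int k" using m assms by (simp add: field_simps)
    ultimately show ?thesis by blast
  qed
  then show ?thesis
    by (intro finite_subset[OF _ finite_vec_entries[of "(\<lambda>m. of_int m / of_int k) ` {- N..N}"]]) auto
qed

text \<open>Strict negativity of \<open>a\<close> gives no uniform rate, since far exponents may lie
  in directions ever closer to the supporting hyperplane. A small multiple of a functional from the
  interior of the dual cone supplies the rate far away, without spoiling the finitely many near
  exponents.\<close>

lemma series_support_exposing_functional:
  fixes \<phi> :: "rat^'n \<Rightarrow> 'k::zero"
  assumes \<phi>: "is_series \<phi>"
    and a: "\<And>I. I \<in> series_support \<phi> \<Longrightarrow> I \<noteq> I0 \<Longrightarrow> a \<bullet> (real_vec I - real_vec I0) < 0"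
  obtains w \<delta> where "0 < \<delta>"
    "\<And>I. I \<in> series_support \<phi> \<Longrightarrow> w \<bullet> (real_vec I - real_vec I0) \<le> - \<delta> * norm (real_vec I - real_vec I0)"
proof -
  obtain v C and k :: int where C: "strictly_convex_rational_cone C" and k: "k \<noteq> 0"
    and supp: "\<And>I. I \<in> series_support \<phi> \<Longrightarrow> real_vec I \<in> (+) v ` C"
      "\<And>I i. I \<in> series_support \<phi> \<Longrightarrow> of_int k * I $ i \<in> \<int>"
    using \<phi> unfolding is_series_def by blast
  obtain c \<gamma> where \<gamma>: "0 < \<gamma>" and c: "\<And>u. u \<in> C \<Longrightarrow> c \<bullet> u \<le> - \<gamma> * norm u"
    using strictly_convex_rational_cone_dual_interior[OF C] by blast
  define y where "y = (\<lambda>I. real_vec I - real_vec I0)"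
  \<comment> \<open>\<open>M\<close> collects the two errors caused by the offset
    \<open>v - real_vec I0\<close>: one in the value of \<open>c\<close>, one in the norm. Beyond
    radius \<open>R\<close>, \<open>M\<close> is at most half of
    \<open>\<gamma> * norm (y I)\<close>, so that half of the rate \<open>\<gamma>\<close>
    survives.\<close>
  define M where "M = norm c * norm (v - real_vec I0) + \<gamma> * norm (v - real_vec I0)"
  define R where "R = 2 * M / \<gamma>"
  have "0 \<le> M" using \<gamma> by (simp add: M_def)
  then have "0 \<le> R" using \<gamma> by (simp add: R_def)
  have far: "c \<bullet> y I \<le> M - \<gamma> * norm (y I)" if I: "I \<in> series_support \<phi>" for I
  proof -
    obtain u where u: "u \<in> C" "real_vec I = v + u" using supp(1)[OF I] by blast
    have "c \<bullet> y I = c \<bullet> (v - real_vec I0) + c \<bullet> u"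
      by (simp add: y_def u inner_add_right inner_diff_right)
    moreover have "\<gamma> * norm (y I) \<le> \<gamma> * (norm (v - real_vec I0) + norm u)"
      using \<gamma> norm_triangle_ineq[of "v - real_vec I0" u]
      by (intro mult_left_mono) (simp_all add: y_def u algebra_simps)
    ultimately show ?thesis
      using norm_cauchy_schwarz[of c "v - real_vec I0"] c[OF u(1)]
      by (simp add: M_def distrib_left)
  qed
  define F where "F = y ` {I \<in> series_support \<phi>. norm (y I) \<le> R}"
  have "finite F"
  proof -
    have "norm (real_vec I) \<le> R + norm (real_vec I0)" if "norm (y I) \<le> R" for I
      using that norm_triangle_ineq[of "y I" "real_vec I0"] by (simp add: y_def)
    then have "{I \<in> series_support \<phi>. norm (y I) \<le> R} \<subseteq>
      {I. (\<forall>i. of_int k * I $ i \<in> \<int>) \<and> norm (real_vec I) \<le> R + norm (real_vec I0)}"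
      using supp(2) by blast
    then show ?thesis
      unfolding F_def using finite_lattice_ball[OF k] finite_subset by blast
  qed
  moreover have "a \<bullet> s < 0" if "s \<in> F" "s \<noteq> 0" for s
    using that a by (auto simp: F_def y_def)
  ultimately obtain \<eta> where \<eta>: "0 < \<eta>" and near: "\<And>s. s \<in> F \<Longrightarrow> a \<bullet> s \<le> - \<eta> * norm s"
    using finite_set_norm_bound[of F a] by blast
  \<comment> \<open>Adding \<open>\<epsilon> *\<^sub>R c\<close> costs at most half of the rate
    \<open>\<eta>\<close> on \<open>F\<close>. The summand 1 keeps the denominator positive when
    \<open>c = 0\<close>.\<close>
  define \<epsilon> where "\<epsilon> = \<eta> / (2 * (norm c + 1))"
  have \<epsilon>: "0 < \<epsilon>" using \<eta> by (simp add: \<epsilon>_def add_nonneg_pos)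
  \<comment> \<open>The first rate holds near \<open>I0\<close>, the second one far from it, where
    \<open>a\<close> contributes nothing positive.\<close>
  define \<delta> where "\<delta> = min (\<eta> / 2) (\<epsilon> * \<gamma> / 2)"
  show thesis
  proof (rule that)
    show "0 < \<delta>" using \<eta> \<epsilon> \<gamma> by (simp add: \<delta>_def)
    fix I assume I: "I \<in> series_support \<phi>"
    have "(a + \<epsilon> *\<^sub>R c) \<bullet> y I \<le> - \<delta> * norm (y I)"
    proof (cases "norm (y I) \<le> R")
      case True
      have "\<epsilon> * (c \<bullet> y I) \<le> \<epsilon> * (norm c * norm (y I))"
        using \<epsilon> norm_cauchy_schwarz by (intro mult_left_mono) auto
      also have "\<dots> \<le> \<eta> / 2 * norm (y I)"
      proof -
        have "\<epsilon> * norm c \<le> \<epsilon> * (norm c + 1)" using \<epsilon> by simp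
        also have "\<dots> = \<eta> / 2"
          using norm_ge_zero[of c] by (simp add: \<epsilon>_def field_simps add_nonneg_eq_0_iff)
        finally show ?thesis
          using mult_right_mono[OF _ norm_ge_zero] by (simp only: mult.assoc[symmetric])
      qed
      finally have "\<epsilon> * (c \<bullet> y I) \<le> \<eta> / 2 * norm (y I)" .
      moreover have "a \<bullet> y I \<le> - \<eta> * norm (y I)"
        using near True I by (auto simp: F_def)
      moreover have "\<delta> * norm (y I) \<le> \<eta> / 2 * norm (y I)"
        by (intro mult_right_mono) (auto simp: \<delta>_def)
      ultimately show ?thesis by (simp add: inner_add_left)
    next
      case False
      have "a \<bullet> y I \<le> 0" using a[OF I] by (cases "I = I0") (auto simp: y_def less_imp_le)
      moreover have "M \<le> \<gamma> / 2 * norm (y I)"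
        using False \<gamma> by (simp add: R_def field_simps)
      then have "c \<bullet> y I \<le> - (\<gamma> / 2 * norm (y I))" using far[OF I] by simp
      then have "\<epsilon> * (c \<bullet> y I) \<le> \<epsilon> * - (\<gamma> / 2 * norm (y I))"
        using \<epsilon> by (intro mult_left_mono) auto
      moreover have "\<delta> * norm (y I) \<le> \<epsilon> * \<gamma> / 2 * norm (y I)"
        by (intro mult_right_mono) (auto simp: \<delta>_def)
      ultimately show ?thesis by (simp add: inner_add_left)
    qed
    then show "(a + \<epsilon> *\<^sub>R c) \<bullet> (real_vec I - real_vec I0) \<le> - \<delta> * norm (real_vec I - real_vec I0)"
      by (simp add: y_def)
  qed
qed

text \<open>The functional that exposes \<open>v\<close> need not induce a total order. Once it is
  replaced by one with a uniform rate of decrease, there is room to perturb it into such a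
  \<open>w\<close>, and the decrease places the support in a translate of a compatible rational
  cone.\<close>

lemma vertex_is_leading_exponent:
  fixes \<phi> :: "rat^'n \<Rightarrow> 'k::zero"
  assumes \<phi>: "is_series \<phi>" and v: "v \<in> vertices (convex hull (real_vec ` series_support \<phi>))"
  obtains w I where "induces_total_order w" "\<phi> \<in> series_field w" "leading_exponent w \<phi> I"
    "real_vec I = v"
proof -
  let ?H = "convex hull (real_vec ` series_support \<phi>)"
  have "{v} face_of ?H" and "\<exists>a b. ?H \<subseteq> {x. a \<bullet> x \<le> b} \<and> {v} = ?H \<inter> {x. a \<bullet> x = b}"
    using v unfolding vertices_def exposed_face_of_def by auto
  then obtain a b where ab: "?H \<subseteq> {x. a \<bullet> x \<le> b}" "{v} = ?H \<inter> {x. a \<bullet> x = b}" by blast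
  have "v \<in> real_vec ` series_support \<phi>"
    using \<open>{v} face_of ?H\<close> by (simp add: face_of_singleton extreme_point_of_convex_hull)
  then obtain I0 where I0: "I0 \<in> series_support \<phi>" "real_vec I0 = v" by blast
  have neg: "a \<bullet> (real_vec I - real_vec I0) < 0" if I: "I \<in> series_support \<phi>" "I \<noteq> I0" for I
  proof -
    have "real_vec I \<in> ?H" using I by (simp add: hull_inc)
    moreover have "real_vec I \<noteq> v" using I I0 by auto
    ultimately have "a \<bullet> real_vec I < b" using ab by force
    moreover have "a \<bullet> v = b" using ab(2) by blast
    ultimately show ?thesis by (simp add: I0 inner_diff_right)
  qed
  have "\<exists>w0 \<delta>. 0 < \<delta> \<and> (\<forall>I\<in>series_support \<phi>.
      w0 \<bullet> (real_vec I - real_vec I0) \<le> - \<delta> * norm (real_vec I - real_vec I0))"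
    by (rule series_support_exposing_functional[OF \<phi> neg]) blast+
  then obtain w0 \<delta> where \<delta>: "0 < \<delta>" and w0: "\<And>I. I \<in> series_support \<phi> \<Longrightarrow>
      w0 \<bullet> (real_vec I - real_vec I0) \<le> - \<delta> * norm (real_vec I - real_vec I0)"
    by blast
  \<comment> \<open>A perturbation smaller than \<open>\<delta> / 2\<close> leaves the rate
    \<open>\<delta> / 2\<close>.\<close>
  obtain w where w: "induces_total_order w" "norm (w - w0) < \<delta> / 2"
    using induces_total_order_dense[of "\<delta> / 2" w0] \<delta> by auto
  have dec: "w \<bullet> (real_vec I - v) \<le> - (\<delta> / 2) * norm (real_vec I - v)"
    if "I \<in> series_support \<phi>" for I
  proof -
    have "w \<bullet> (real_vec I - v) = w0 \<bullet> (real_vec I - v) + (w - w0) \<bullet> (real_vec I - v)"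
      by (simp add: inner_diff_left)
    also have "(w - w0) \<bullet> (real_vec I - v) \<le> norm (w - w0) * norm (real_vec I - v)"
      by (rule norm_cauchy_schwarz)
    also have "\<dots> \<le> \<delta> / 2 * norm (real_vec I - v)"
      using w(2) by (intro mult_right_mono) auto
    finally show ?thesis using w0[OF that] by (simp add: I0)
  qed
  obtain C where C: "strictly_convex_rational_cone C" "compatible_cone w C"
    "\<And>u. w \<bullet> u \<le> - (\<delta> / 2) * norm u \<Longrightarrow> u \<in> C"
    using negative_cone_in_strictly_convex_rational_cone[of "\<delta> / 2" w] \<delta> by auto
  have "real_vec I \<in> (+) (real_vec I0) ` C" if "I \<in> series_support \<phi>" for I
    using C(3)[OF dec[OF that]] by (auto simp: I0 image_iff intro!: bexI[of _ "real_vec I - v"])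
  then have "\<phi> \<in> series_field w"
    unfolding series_field_def using \<phi> C(1,2) by blast
  moreover have "leading_exponent w \<phi> I0"
    unfolding leading_exponent_def exp_maximal_def exp_le_def
  proof (intro conjI ballI)
    fix J assume "J \<in> series_support \<phi>"
    then have "w \<bullet> (real_vec J - v) \<le> 0"
      using dec[of J] \<delta> by (smt (verit) mult_nonneg_nonneg norm_ge_zero mult_minus_left half_gt_zero)
    then show "real_vec J \<bullet> w \<le> real_vec I0 \<bullet> w"
      by (simp add: I0 inner_diff_right inner_commute)
  qed (rule I0)
  ultimately show thesis using that w(1) I0(2) by blast
qed

text \<open>An open half-space together with a single point of its boundary is convex. Such a set
  contains the support, hence also its hull, which therefore meets the hyperplane in that point
  only.\<close>

lemma leading_exponent_is_vertex:
  fixes \<phi> :: "rat^'n \<Rightarrow> 'k::zero"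
  assumes w: "induces_total_order w" and I: "leading_exponent w \<phi> I"
  shows "real_vec I \<in> vertices (convex hull (real_vec ` series_support \<phi>))"
proof -
  let ?S = "real_vec ` series_support \<phi>"
  let ?b = "w \<bullet> real_vec I"
  have supp: "I \<in> series_support \<phi>" "\<And>x. x \<in> ?S \<Longrightarrow> w \<bullet> x \<le> ?b"
    using I by (auto simp: leading_exponent_def exp_maximal_def exp_le_def inner_commute)
  have uniq: "x = real_vec I" if "x \<in> ?S" "w \<bullet> x = ?b" for x
    using that induces_total_order_inj[OF w] by (auto simp: inner_commute[of w])
  have "convex hull ?S \<subseteq> {x. w \<bullet> x < ?b} \<union> {real_vec I}"
  proof (rule hull_minimal)
    show "?S \<subseteq> {x. w \<bullet> x < ?b} \<union> {real_vec I}" using supp(2) uniq by force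
    show "convex ({x. w \<bullet> x < ?b} \<union> {real_vec I})"
      unfolding convex_alt
    proof (intro ballI allI impI)
      fix x y :: "real^'n" and u :: real
      assume x: "x \<in> {x. w \<bullet> x < ?b} \<union> {real_vec I}" and y: "y \<in> {x. w \<bullet> x < ?b} \<union> {real_vec I}"
        and u: "0 \<le> u \<and> u \<le> 1"
      let ?z = "(1 - u) *\<^sub>R x + u *\<^sub>R y"
      have z: "w \<bullet> ?z - ?b = (1 - u) * (w \<bullet> x - ?b) + u * (w \<bullet> y - ?b)"
        by (simp add: inner_add_right algebra_simps)
      consider "u = 0" | "u = 1" | "0 < u" "u < 1" using u by linarith
      then show "?z \<in> {x. w \<bullet> x < ?b} \<union> {real_vec I}"
      proof cases
        case 3
        show ?thesis
        proof (cases "x = real_vec I \<and> y = real_vec I")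
          case True
          then have "?z = real_vec I" by (simp flip: scaleR_left_distrib)
          then show ?thesis by simp
        next
          case False
          \<comment> \<open>At least one of the two points lies strictly below the hyperplane, and
            its weight is positive.\<close>
          then have "(1 - u) * (w \<bullet> x - ?b) + u * (w \<bullet> y - ?b) < 0"
            using x y 3 by (auto simp: mult_less_0_iff intro: add_neg_neg)
          with z show ?thesis by simp
        qed
      qed (use x y in auto)
    qed
  qed
  moreover have "real_vec I \<in> convex hull ?S" using supp(1) by (simp add: hull_inc)
  ultimately have "convex hull ?S \<inter> {x. w \<bullet> x = ?b} = {real_vec I}"
    "\<And>x. x \<in> convex hull ?S \<Longrightarrow> w \<bullet> x \<le> ?b" by force+
  then show ?thesis
    unfolding vertices_def using exposed_point_of_Int_supporting_hyperplane_le by blast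
qed

section \<open>Coefficients of highest order after substitution\<close>

lemma rat_exponent_eq_iff: "rat_exponent m = rat_exponent m' \<longleftrightarrow> m = m'"
  by (auto simp: rat_exponent_def vec_eq_iff intro: poly_mapping_eqI)

lemma series_of_coeff_rat_exponent:
  "series_of_coeff q (rat_exponent m) = Poly_Mapping.lookup q m"
proof -
  have "{m'. m' \<in> Poly_Mapping.keys q \<and> rat_exponent m' = rat_exponent m}
      = (if Poly_Mapping.lookup q m = 0 then {} else {m})"
    by (auto simp: rat_exponent_eq_iff in_keys_iff)
  then show ?thesis by (simp add: series_of_coeff_def)
qed

lemma series_of_coeff_nonzeroE:
  assumes "series_of_coeff q J \<noteq> 0"
  obtains m where "J = rat_exponent m" "Poly_Mapping.lookup q m \<noteq> 0"
proof -
  obtain m where "m \<in> {m. m \<in> Poly_Mapping.keys q \<and> rat_exponent m = J}"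
    using assms unfolding series_of_coeff_def by (rule sum.not_neutral_contains_not_neutral)
  then show thesis by (intro that[of m]) (simp_all add: in_keys_iff)
qed

text \<open>A product reaches the sum of the two leading orders only through both leading terms.
  Nothing is claimed below that order. At the exponents considered, the index set of the product is
  empty or a singleton, so the value 0 of sums over infinite sets never enters.\<close>

lemma series_power_above_leading:
  fixes \<phi> :: "rat^'n \<Rightarrow> 'k::idom"
  assumes w: "induces_total_order w" and I0: "leading_exponent w \<phi> I0"
    and "real j * (real_vec I0 \<bullet> w) \<le> real_vec J \<bullet> w"
  shows "series_power \<phi> j J = (if J = of_nat j *s I0 then \<phi> I0 ^ j else 0)"
  using assms(3)
proof (induction j arbitrary: J)
  case 0
  show ?case by (simp add: vec_eq_iff)
next
  case (Suc j)
  have nz: "\<phi> I0 \<noteq> 0" and top: "\<And>L. \<phi> L \<noteq> 0 \<Longrightarrow> real_vec L \<bullet> w \<le> real_vec I0 \<bullet> w"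
    using I0 by (auto simp: leading_exponent_def exp_maximal_def exp_le_def series_support_def)
  have Suc_smult: "of_nat (Suc j) *s I0 = I0 + of_nat j *s I0"
    by (simp add: vec_eq_iff algebra_simps)
  \<comment> \<open>As \<open>L\<close> is at most \<open>I0\<close>, the remainder
    \<open>J - L\<close> is high enough for the induction hypothesis, which determines it. Then
    \<open>L\<close> is also at least \<open>I0\<close>.\<close>
  have only: "L = I0 \<and> J = of_nat (Suc j) *s I0"
    if L: "\<phi> L \<noteq> 0" "series_power \<phi> j (J - L) \<noteq> 0" for L
  proof -
    have "real j * (real_vec I0 \<bullet> w) \<le> real_vec (J - L) \<bullet> w"
      using Suc.prems top[OF L(1)] by (simp add: real_vec_diff inner_diff_left algebra_simps)
    then have JL: "J - L = of_nat j *s I0" using Suc.IH[of "J - L"] L(2) by presburger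
    then have J: "J = L + of_nat j *s I0" by (simp add: algebra_simps)
    have "real_vec I0 \<bullet> w \<le> real_vec L \<bullet> w"
      using Suc.prems by (simp add: J real_vec_add real_vec_of_nat_mult inner_add_left algebra_simps)
    then have "L = I0" using top[OF L(1)] induces_total_order_inj[OF w] by force
    with J show ?thesis by (simp only: Suc_smult)
  qed
  show ?case
  proof (cases "J = of_nat (Suc j) *s I0")
    case True
    then have J: "J - I0 = of_nat j *s I0" by (simp only: Suc_smult) simp
    have pow: "series_power \<phi> j (J - I0) = \<phi> I0 ^ j"
      unfolding J by (subst Suc.IH) (simp_all add: real_vec_of_nat_mult)
    have "{L. \<phi> L \<noteq> 0 \<and> series_power \<phi> j (J - L) \<noteq> 0} = {I0}"
    proof (intro equalityI subsetI)
      fix L assume "L \<in> {L. \<phi> L \<noteq> 0 \<and> series_power \<phi> j (J - L) \<noteq> 0}"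
      then show "L \<in> {I0}" using only[of L] by simp
    qed (simp add: pow nz)
    then show ?thesis using True pow by (simp add: series_mult_def)
  next
    case False
    then have "{L. \<phi> L \<noteq> 0 \<and> series_power \<phi> j (J - L) \<noteq> 0} = {}"
      using only by blast
    then show ?thesis using False by (simp only: series_power.simps series_mult_def if_False sum.empty)
  qed
qed

text \<open>If no monomial exceeds the order of \<open>E\<close> when \<open>y\<close> is replaced
  by the leading term of \<open>\<phi>\<close>, then lower terms of \<open>\<phi>\<close> cannot
  contribute at \<open>E\<close>.\<close>

lemma series_eval_leading:
  fixes \<phi> :: "rat^'n \<Rightarrow> 'k::idom"
  assumes w: "induces_total_order w" and I0: "leading_exponent w \<phi> I0"
    and E: "\<And>m j. Poly_Mapping.lookup (coeff p j) m \<noteq> 0 \<Longrightarrow>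
      real_vec (rat_exponent m + of_nat j *s I0) \<bullet> w \<le> real_vec E \<bullet> w"
  shows "series_eval p \<phi> E = (\<Sum>j\<le>degree p. series_of_coeff (coeff p j) (E - of_nat j *s I0) * \<phi> I0 ^ j)"
  unfolding series_eval_def
proof (rule sum.cong[OF refl])
  fix j
  let ?q = "series_of_coeff (coeff p j)" and ?x = "E - of_nat j *s I0"
  have pow: "series_power \<phi> j (E - ?x) = \<phi> I0 ^ j"
    by (subst series_power_above_leading[OF w I0]) (simp_all add: real_vec_of_nat_mult)
  have "J = ?x" if J: "?q J \<noteq> 0" "series_power \<phi> j (E - J) \<noteq> 0" for J
  proof -
    obtain m where m: "J = rat_exponent m" "Poly_Mapping.lookup (coeff p j) m \<noteq> 0"
      using J(1) by (rule series_of_coeff_nonzeroE)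
    have "real j * (real_vec I0 \<bullet> w) \<le> real_vec (E - J) \<bullet> w"
      using E[OF m(2)]
      by (simp add: m(1) real_vec_diff real_vec_add real_vec_of_nat_mult inner_diff_left inner_add_left)
    then have "E - J = of_nat j *s I0"
      using series_power_above_leading[OF w I0, of j "E - J"] J(2) by presburger
    then show ?thesis by (metis diff_diff_eq2 add_diff_cancel_left')
  qed
  then have "{J. ?q J \<noteq> 0 \<and> series_power \<phi> j (E - J) \<noteq> 0} \<subseteq> {?x}" by blast
  \<comment> \<open>The index set is empty when \<open>?q ?x = 0\<close>. Summing over the singleton
    covers both cases.\<close>
  then have "series_mult ?q (series_power \<phi> j) E = (\<Sum>J\<in>{?x}. ?q J * series_power \<phi> j (E - J))"
    unfolding series_mult_def by (intro sum.mono_neutral_left) auto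
  with pow show "series_mult ?q (series_power \<phi> j) E = ?q ?x * \<phi> I0 ^ j" by simp
qed

section \<open>The edge on which the leading terms cancel\<close>

lemma finite_poly_support: "finite (poly_support p)"
proof -
  have "poly_support p \<subseteq> (\<lambda>(j, m). (real_vec (rat_exponent m), of_nat j)) `
      (SIGMA j:{..degree p}. Poly_Mapping.keys (coeff p j))"
  proof
    fix u assume "u \<in> poly_support p"
    then obtain m j where u: "u = (real_vec (rat_exponent m), of_nat j)"
      "Poly_Mapping.lookup (coeff p j) m \<noteq> 0" unfolding poly_support_def by blast
    then have "coeff p j \<noteq> 0" by auto
    then have "j \<le> degree p" by (rule le_degree)
    with u show "u \<in> (\<lambda>(j, m). (real_vec (rat_exponent m), of_nat j)) `
        (SIGMA j:{..degree p}. Poly_Mapping.keys (coeff p j))"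
      by (intro image_eqI[of _ _ "(j, m)"]) (simp_all add: in_keys_iff)
  qed
  then show ?thesis by (rule finite_subset) auto
qed

lemma poly_support_nonempty:
  assumes "p \<noteq> 0"
  shows "poly_support p \<noteq> {}"
proof -
  have "Poly_Mapping.keys (lead_coeff p) \<noteq> {}" using assms by simp
  then obtain m where "m \<in> Poly_Mapping.keys (lead_coeff p)" by blast
  then have "Poly_Mapping.lookup (lead_coeff p) m \<noteq> 0" by (simp add: in_keys_iff)
  then show ?thesis unfolding poly_support_def by blast
qed

lemma leading_exponent_of_root_is_edge_slope:
  fixes p :: "(('n::finite \<Rightarrow>\<^sub>0 nat) \<Rightarrow>\<^sub>0 'k::idom) poly"
  assumes p: "p \<noteq> 0" and root: "series_eval p \<phi> = (\<lambda>I. 0)"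
    and w: "induces_total_order w" and I0: "leading_exponent w \<phi> I0"
  obtains e where "admissible_edge p e" "w \<in> dual_barrier_cone p e" "slope e = - real_vec I0"
proof -
  define v where "v = real_vec I0"
  \<comment> \<open>On a support point, \<open>g\<close> is the order of the leading exponent of
    that monomial after \<open>\<phi>\<close> is substituted for \<open>y\<close>.\<close>
  define g where "g = (w, v \<bullet> w)"
  have g: "g \<bullet> u = (fst u + snd u *\<^sub>R v) \<bullet> w" for u
    by (simp add: g_def inner_prod_def inner_add_left inner_commute[of w] mult.commute)
  have shift: "real_vec (rat_exponent m) + real j *\<^sub>R v = real_vec (rat_exponent m + of_nat j *s I0)"
    for m :: "'n \<Rightarrow>\<^sub>0 nat" and j
    by (simp add: v_def real_vec_add real_vec_of_nat_mult)
  let ?S = "poly_support p"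
  define \<beta> where "\<beta> = Max ((\<bullet>) g ` ?S)"
  have le: "g \<bullet> u \<le> \<beta>" if "u \<in> ?S" for u
    unfolding \<beta>_def using that finite_poly_support by (intro Max_ge) auto
  have "\<beta> \<in> (\<bullet>) g ` ?S"
    unfolding \<beta>_def using finite_poly_support poly_support_nonempty[OF p] by (intro Max_in) auto
  then obtain u0 where u0: "u0 \<in> ?S" "g \<bullet> u0 = \<beta>" by blast
  then obtain m0 j0 where m0: "u0 = (real_vec (rat_exponent m0), real j0)"
    "Poly_Mapping.lookup (coeff p j0) m0 \<noteq> 0" unfolding poly_support_def by blast
  \<comment> \<open>All monomials that maximize \<open>g\<close> lead to this same exponent, because
    \<open>w\<close> separates exponents. The coefficient at \<open>E\<close> collects exactly
    these.\<close>
  define E where "E = rat_exponent m0 + of_nat j0 *s I0"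
  have \<beta>E: "\<beta> = real_vec E \<bullet> w"
    using u0(2) unfolding m0(1) g by (simp add: shift E_def)
  have "real_vec (rat_exponent m + of_nat j *s I0) \<bullet> w \<le> real_vec E \<bullet> w"
    if "Poly_Mapping.lookup (coeff p j) m \<noteq> 0" for m j
  proof -
    have "(real_vec (rat_exponent m), real j) \<in> ?S" unfolding poly_support_def using that by blast
    from le[OF this] show ?thesis unfolding g \<beta>E by (simp add: shift)
  qed
  then have eval: "series_eval p \<phi> E = (\<Sum>j\<le>degree p. series_of_coeff (coeff p j) (E - of_nat j *s I0) * \<phi> I0 ^ j)"
    by (rule series_eval_leading[OF w I0])
  have nz: "\<phi> I0 \<noteq> 0"
    using I0 by (simp add: leading_exponent_def exp_maximal_def series_support_def)
  let ?t = "\<lambda>j. series_of_coeff (coeff p j) (E - of_nat j *s I0)"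
  have "?t j0 = Poly_Mapping.lookup (coeff p j0) m0"
    by (simp add: E_def series_of_coeff_rat_exponent)
  then have t0: "?t j0 * \<phi> I0 ^ j0 \<noteq> 0" using m0(2) nz by simp
  have "j0 \<le> degree p" using m0(2) by (intro le_degree) auto
  \<comment> \<open>The term of \<open>j0\<close> is non-zero but the whole sum vanishes, so another
    power of \<open>y\<close> must contribute.\<close>
  then have "(\<Sum>j\<le>degree p. ?t j * \<phi> I0 ^ j)
      = ?t j0 * \<phi> I0 ^ j0 + (\<Sum>j\<in>{..degree p} - {j0}. ?t j * \<phi> I0 ^ j)"
    by (intro sum.remove) auto
  moreover have "(\<Sum>j\<le>degree p. ?t j * \<phi> I0 ^ j) = 0" using eval root by simp
  ultimately have "(\<Sum>j\<in>{..degree p} - {j0}. ?t j * \<phi> I0 ^ j) \<noteq> 0" using t0 by auto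
  then obtain j1 where j1: "j1 \<in> {..degree p} - {j0}" "?t j1 * \<phi> I0 ^ j1 \<noteq> 0"
    by (rule sum.not_neutral_contains_not_neutral)
  then have "?t j1 \<noteq> 0" by auto
  then obtain m1 where m1: "E - of_nat j1 *s I0 = rat_exponent m1" "Poly_Mapping.lookup (coeff p j1) m1 \<noteq> 0"
    by (rule series_of_coeff_nonzeroE)
  define u1 where "u1 = (real_vec (rat_exponent m1), real j1)"
  have u1: "u1 \<in> ?S" unfolding poly_support_def u1_def using m1(2) by blast
  have "rat_exponent m1 + of_nat j1 *s I0 = E" using m1(1) by (simp add: algebra_simps)
  then have gu1: "g \<bullet> u1 = \<beta>" unfolding u1_def g \<beta>E by (simp add: shift)
  \<comment> \<open>This is the line with direction \<open>(- v, 1)\<close> on which the maximal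
    support points lie.\<close>
  define L where "L = {u. fst u + snd u *\<^sub>R v = real_vec E}"
  have onL: "u \<in> L" if u: "u \<in> ?S" "g \<bullet> u = \<beta>" for u
  proof -
    obtain m j where m: "u = (real_vec (rat_exponent m), real j)"
      using u(1) unfolding poly_support_def by blast
    have "real_vec (rat_exponent m + of_nat j *s I0) \<bullet> w = real_vec E \<bullet> w"
      using u(2) unfolding m g \<beta>E by (simp add: shift)
    then have "rat_exponent m + of_nat j *s I0 = E" by (rule induces_total_order_inj[OF w])
    then show ?thesis by (simp add: L_def m shift)
  qed
  have "convex L"
    unfolding convex_def
  proof (intro ballI allI impI)
    fix x y :: "(real^'n) \<times> real" and a b :: real
    assume x: "x \<in> L" and y: "y \<in> L" and "0 \<le> a" "0 \<le> b" and ab: "a + b = 1"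
    have "fst (a *\<^sub>R x + b *\<^sub>R y) + snd (a *\<^sub>R x + b *\<^sub>R y) *\<^sub>R v
        = a *\<^sub>R (fst x + snd x *\<^sub>R v) + b *\<^sub>R (fst y + snd y *\<^sub>R v)"
      by (simp add: algebra_simps)
    also have "\<dots> = real_vec E" using x y ab by (simp add: L_def flip: scaleR_left_distrib)
    finally show "a *\<^sub>R x + b *\<^sub>R y \<in> L" by (simp add: L_def)
  qed
  have "collinear L"
    unfolding collinear_def
  proof (intro exI ballI)
    fix x y assume "x \<in> L" "y \<in> L"
    then have "fst x - fst y = (snd x - snd y) *\<^sub>R (- v)"
      by (simp add: L_def algebra_simps)
    then show "x - y = (snd x - snd y) *\<^sub>R (- v, 1)" by (simp add: prod_eq_iff)
  qed
  define e where "e = Newt p \<inter> {x. g \<bullet> x = \<beta>}"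
  have NewtS: "?S \<subseteq> Newt p" unfolding Newt_def by (rule hull_subset)
  have "Newt p \<subseteq> {x. g \<bullet> x \<le> \<beta>}"
    unfolding Newt_def using le by (intro hull_minimal convex_halfspace_le) auto
  then have Newt_le: "\<And>x. x \<in> Newt p \<Longrightarrow> g \<bullet> x \<le> \<beta>" by blast
  have face: "e face_of Newt p"
    unfolding e_def by (intro face_of_Int_supporting_hyperplane_le Newt_le) (simp_all add: Newt_def)
  \<comment> \<open>A face of the hull is itself the hull of support points, so it lies in
    \<open>L\<close> as soon as these do.\<close>
  then obtain S' where S': "S' \<subseteq> ?S" "e = convex hull S'"
    unfolding Newt_def
    using face_of_convex_hull_subset[OF finite_imp_compact[OF finite_poly_support]] by metis
  have "S' \<subseteq> e" using S'(2) by (simp add: hull_subset)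
  then have "S' \<subseteq> L" using S'(1) onL unfolding e_def by blast
  then have eL: "e \<subseteq> L" unfolding S'(2) using \<open>convex L\<close> by (rule hull_minimal)
  have mem: "u0 \<in> e" "u1 \<in> e" using u0 u1 gu1 NewtS by (auto simp: e_def)
  have ne: "u0 \<noteq> u1" using j1(1) by (simp add: m0 u1_def)
  have "compact e"
    unfolding S'(2) using S'(1) finite_poly_support finite_subset by (intro finite_imp_compact_convex_hull) blast
  moreover have "convex e" unfolding S'(2) by simp
  moreover have "collinear e" using \<open>collinear L\<close> eL by (rule collinear_subset)
  ultimately obtain a b where ab: "e = closed_segment a b"
    using compact_convex_collinear_segment mem by blast
  have "a \<noteq> b" using mem ne unfolding ab by auto
  have aL: "fst a + snd a *\<^sub>R v = real_vec E" and bL: "fst b + snd b *\<^sub>R v = real_vec E"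
    using eL unfolding ab L_def by auto
  have fab: "fst b - fst a = - ((snd b - snd a) *\<^sub>R v)"
    using aL bL by (simp add: algebra_simps)
  \<comment> \<open>Points of \<open>L\<close> with equal last components coincide.\<close>
  have snd: "snd a \<noteq> snd b" using fab \<open>a \<noteq> b\<close> by (auto simp: prod_eq_iff)
  have "aff_dim e = 1" unfolding ab segment_convex_hull using \<open>a \<noteq> b\<close> by (simp add: aff_dim_convex_hull)
  with face ab snd have adm: "admissible_edge p e"
    unfolding admissible_edge_def edge_of_def by blast
  have slope: "slope e = - v"
    using snd unfolding ab slope_closed_segment[OF snd] fab by simp
  \<comment> \<open>As the slope is \<open>- v\<close>, the value of \<open>w\<close> at
    \<open>edge_proj e u\<close> is \<open>g \<bullet> u\<close>. Maximality of \<open>g\<close> on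
    \<open>e\<close> thus becomes the sign condition on the barrier cone.\<close>
  have "{edge_proj e u - edge_proj e u' | u u'. u \<in> Newt p \<and> u' \<in> e} \<subseteq> {x. w \<bullet> x \<le> 0}"
  proof clarify
    fix u u' assume "u \<in> Newt p" "u' \<in> e"
    then have "g \<bullet> u \<le> \<beta>" "g \<bullet> u' = \<beta>" using Newt_le by (auto simp: e_def)
    then show "w \<bullet> (edge_proj e u - edge_proj e u') \<le> 0"
      by (simp add: edge_proj_def slope g inner_diff_right inner_commute)
  qed
  then have "barrier_cone p e \<subseteq> {x. w \<bullet> x \<le> 0}"
    unfolding barrier_cone_def by (rule hull_minimal) (rule convex_cone_halfspace_le)
  then have "w \<in> dual_barrier_cone p e"
    by (auto simp: dual_barrier_cone_def inner_commute)
  with adm slope show thesis using that v_def by blast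
qed

theorem proposition3:
  fixes p :: "(('n::finite \<Rightarrow>\<^sub>0 nat) \<Rightarrow>\<^sub>0 'k::{alg_closed_field, field_char_0}) poly"
    and \<phi> :: "rat^'n \<Rightarrow> 'k"
  assumes "p \<noteq> 0" and "squarefree p" and "is_series_root p \<phi>"
  shows "\<exists>f. f ` {e. admissible_edge p e \<and> gives_rise_to p e \<phi>} =
             vertices (convex hull (real_vec ` series_support \<phi>))"
proof (intro exI equalityI subsetI)
  fix v assume "v \<in> (\<lambda>e. - slope e) ` {e. admissible_edge p e \<and> gives_rise_to p e \<phi>}"
  then obtain w I where "induces_total_order w" "leading_exponent w \<phi> I" "v = real_vec I"
    unfolding gives_rise_to_def constructed_series_roots_def by auto
  then show "v \<in> vertices (convex hull (real_vec ` series_support \<phi>))"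
    using leading_exponent_is_vertex by blast
next
  have \<phi>: "is_series \<phi>" "series_eval p \<phi> = (\<lambda>I. 0)"
    using assms(3) unfolding is_series_root_def by blast+
  fix v assume "v \<in> vertices (convex hull (real_vec ` series_support \<phi>))"
  with \<phi>(1) obtain w I where w: "induces_total_order w" "\<phi> \<in> series_field w" "leading_exponent w \<phi> I"
    and v: "real_vec I = v"
    by (rule vertex_is_leading_exponent)
  obtain e where e: "admissible_edge p e" "w \<in> dual_barrier_cone p e" "slope e = - real_vec I"
    using leading_exponent_of_root_is_edge_slope[OF assms(1) \<phi>(2) w(1,3)] .
  have "\<phi> \<in> constructed_series_roots p e w"
    unfolding constructed_series_roots_def using w assms(3) e(3) by auto
  then have "gives_rise_to p e \<phi>"
    unfolding gives_rise_to_def using w e by blast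
  with e(1,3) v show "v \<in> (\<lambda>e. - slope e) ` {e. admissible_edge p e \<and> gives_rise_to p e \<phi>}"
    by (auto simp: image_iff intro!: bexI[of _ e])
qed

end
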